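(* Let $H$ be a separable real Hilbert space, $A$ a self-adjoint, positive coercive operator on $H$, $\lambda_1=\lambda_1(A)$ the smallest spectral value of $A$, and $V=D(A^{1/2})$. Let $c\in\mathbb{R}$ with $c\ne0$ and $|c|<\lambda_1$, and consider the system $$u''+u'+Au+cv=0,\qquad v''+Av+cu=0. \qquad (S)$$ Let $$E(u,v,w,z)=\tfrac12\left(\|u\|^2+\|v\|^2+|w|^2+|z|^2\right)+c(u,v).$$ Then for every fixed $p>1$ such that $$\frac{p+1}{p-1}<\frac{\lambda_1}{|c|},$$ there exists $\varepsilon_0>0$ such that for all $\varepsilon\in(0,\varepsilon_0)$ the quadratic form on $V\times V\times H\times H$ $$H_\varepsilon(u,v,w,z)=E(u,v,w,z)-\varepsilon\lambda_1(v,z)_*+p\varepsilon(u,w)+\rho\varepsilon\left[(w,v)-(u,z)\right],\qquad \rho=\frac{(p+1)\lambda_1}{2c},$$ satisfies, for some constant $\gamma(p,\varepsilon)>0$ independent of the solution, the inequality $$\frac{d}{dt}H_\varepsilon(u,v,u',v')\le-\gamma(p,\varepsilon)\,\tfrac12\left(|u|^2+|v|^2+\|u'\|_*^2+\|v'\|_*^2\right)$$ on $\mathbb{R}^+$ for every weak solution $(u,v)$ of $(S)$.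
   Context: $(\cdot,\cdot)$ and $|\cdot|$ are the inner product and norm of $H$. $V=D(A^{1/2})$ has norm $\|u\|=|A^{1/2}u|$; $H$ is identified with its dual so that $V\subset H\subset V'$, and $A$ is extended to an operator in $L(V,V')$. $\lambda_1$ is the largest constant with $\|u\|^2\ge\lambda_1|u|^2$ for all $u\in V$. $(\cdot,\cdot)_*$ and $\|\cdot\|_*$ are the inner product and norm of $V'$ dual to those of $V$: $(f,g)_*=\langle f,A^{-1}g\rangle$ and $\|f\|_*^2=\langle f,A^{-1}f\rangle$; in particular $(f,g)_*=(A^{-1/2}f,A^{-1/2}g)$ for $f,g\in H$. A weak solution of $(S)$ is a pair $(u,v)$ with $(u,v,u',v')\in C(\mathbb{R}^+,V\times V\times H\times H)\cap C^1(\mathbb{R}^+,H\times H\times V'\times V')$ satisfying $(S)$ in $V'$. *)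

theory Defs
  imports "HOL-Analysis.Analysis"
begin

section \<open>Unbounded operators on a real Hilbert space\<close>

text \<open>An unbounded operator is a pair of a domain \<open>D\<close> and a function \<open>A\<close> on the whole type, of which
  only the values on \<open>D\<close> matter.\<close>

definition linear_op :: "'h::real_inner set \<Rightarrow> ('h \<Rightarrow> 'h) \<Rightarrow> bool" where
  "linear_op D A \<longleftrightarrow> subspace D \<and>
     (\<forall>x\<in>D. \<forall>y\<in>D. A (x + y) = A x + A y) \<and> (\<forall>r. \<forall>x\<in>D. A (r *\<^sub>R x) = r *\<^sub>R A x)"

definition op_graph :: "'h set \<Rightarrow> ('h \<Rightarrow> 'h) \<Rightarrow> ('h \<times> 'h) set" where
  "op_graph D A = {(x, A x) |x. x \<in> D}"

definition adjoint_graph :: "'h::real_inner set \<Rightarrow> ('h \<Rightarrow> 'h) \<Rightarrow> ('h \<times> 'h) set" where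
  "adjoint_graph D A = {(y, z). \<forall>x\<in>D. A x \<bullet> y = x \<bullet> z}"

definition self_adjoint :: "'h::real_inner set \<Rightarrow> ('h \<Rightarrow> 'h) \<Rightarrow> bool" where
  "self_adjoint D A \<longleftrightarrow> linear_op D A \<and> closure D = UNIV \<and> adjoint_graph D A = op_graph D A"

definition positive_op :: "'h::real_inner set \<Rightarrow> ('h \<Rightarrow> 'h) \<Rightarrow> bool" where
  "positive_op D A \<longleftrightarrow> (\<forall>x\<in>D. 0 \<le> A x \<bullet> x)"

definition coercive_op :: "'h::real_inner set \<Rightarrow> ('h \<Rightarrow> 'h) \<Rightarrow> bool" where
  "coercive_op D A \<longleftrightarrow> (\<exists>\<alpha>>0. \<forall>x\<in>D. \<alpha> * (norm x)\<^sup>2 \<le> A x \<bullet> x)"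

text \<open>\<open>S\<close> with domain \<open>V\<close> is the operator \<open>A\<^sup>1\<^sup>/\<^sup>2\<close>, characterised as the unique positive self-adjoint
  operator whose square is \<open>A\<close>, equality of domains included.\<close>

definition is_sqrt_op :: "'h::real_inner set \<Rightarrow> ('h \<Rightarrow> 'h) \<Rightarrow> 'h set \<Rightarrow> ('h \<Rightarrow> 'h) \<Rightarrow> bool" where
  "is_sqrt_op D A V S \<longleftrightarrow> self_adjoint V S \<and> positive_op V S \<and>
     D = {x \<in> V. S x \<in> V} \<and> (\<forall>x\<in>D. A x = S (S x))"

text \<open>The real spectrum; for a self-adjoint operator it is the whole spectrum of the
  complexification.\<close>

definition resolvent_set :: "'h::real_inner set \<Rightarrow> ('h \<Rightarrow> 'h) \<Rightarrow> real set" where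
  "resolvent_set D A = {\<mu>. bij_betw (\<lambda>x. A x - \<mu> *\<^sub>R x) D UNIV \<and>
     (\<exists>K. \<forall>x\<in>D. norm x \<le> K * norm (A x - \<mu> *\<^sub>R x))}"

definition spectrum :: "'h::real_inner set \<Rightarrow> ('h \<Rightarrow> 'h) \<Rightarrow> real set" where
  "spectrum D A = - resolvent_set D A"

definition smallest_spectral_value :: "'h::real_inner set \<Rightarrow> ('h \<Rightarrow> 'h) \<Rightarrow> real \<Rightarrow> bool" where
  "smallest_spectral_value D A lambda1 \<longleftrightarrow> lambda1 \<in> spectrum D A \<and> (\<forall>\<mu>\<in>spectrum D A. lambda1 \<le> \<mu>)"


section \<open>The spaces \<open>V\<close> and \<open>V'\<close>\<close>

definition norm_V :: "('h::real_inner \<Rightarrow> 'h) \<Rightarrow> 'h \<Rightarrow> real" where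
  "norm_V S x = norm (S x)"

text \<open>An element of \<open>V'\<close> is represented by a function on the whole type; its values outside \<open>V\<close> are
  irrelevant, and equality in \<open>V'\<close> is equality on \<open>V\<close>.\<close>

definition dual_V :: "'h::real_inner set \<Rightarrow> ('h \<Rightarrow> 'h) \<Rightarrow> ('h \<Rightarrow> real) set" where
  "dual_V V S = {f. (\<forall>x\<in>V. \<forall>y\<in>V. f (x + y) = f x + f y) \<and> (\<forall>r. \<forall>x\<in>V. f (r *\<^sub>R x) = r * f x) \<and>
     (\<exists>K. \<forall>x\<in>V. \<bar>f x\<bar> \<le> K * norm_V S x)}"

text \<open>The inclusion of \<open>H\<close> in \<open>V'\<close>.\<close>

definition pivot :: "'h::real_inner \<Rightarrow> ('h \<Rightarrow> real)" where
  "pivot h = (\<lambda>\<phi>. h \<bullet> \<phi>)"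

text \<open>The extension of \<open>A\<close> to an operator \<open>V \<rightarrow> V'\<close>, in terms of \<open>S = A\<^sup>1\<^sup>/\<^sup>2\<close>.\<close>

definition ext_op :: "('h::real_inner \<Rightarrow> 'h) \<Rightarrow> 'h \<Rightarrow> ('h \<Rightarrow> real)" where
  "ext_op S x = (\<lambda>\<phi>. S x \<bullet> S \<phi>)"

lemma ext_op_extends:
  assumes "is_sqrt_op D A V S" "x \<in> D" "\<phi> \<in> V"
  shows "ext_op S x \<phi> = pivot (A x) \<phi>"
proof -
  have V: "x \<in> V" "S x \<in> V" "A x = S (S x)" "self_adjoint V S"
    using assms by (auto simp: is_sqrt_op_def)
  then have "(\<phi>, S \<phi>) \<in> adjoint_graph V S"
    using assms(3) by (auto simp: self_adjoint_def op_graph_def)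
  then show ?thesis
    using V by (simp add: adjoint_graph_def ext_op_def pivot_def)
qed

definition inv_A :: "'h::real_inner set \<Rightarrow> ('h \<Rightarrow> 'h) \<Rightarrow> ('h \<Rightarrow> real) \<Rightarrow> 'h" where
  "inv_A V S f = (THE w. w \<in> V \<and> (\<forall>\<phi>\<in>V. ext_op S w \<phi> = f \<phi>))"

definition inner_dual :: "'h::real_inner set \<Rightarrow> ('h \<Rightarrow> 'h) \<Rightarrow> ('h \<Rightarrow> real) \<Rightarrow> ('h \<Rightarrow> real) \<Rightarrow> real" where
  "inner_dual V S f g = f (inv_A V S g)"

definition norm_dual :: "'h::real_inner set \<Rightarrow> ('h \<Rightarrow> 'h) \<Rightarrow> ('h \<Rightarrow> real) \<Rightarrow> real" where
  "norm_dual V S f = sqrt (inner_dual V S f f)"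


section \<open>Weak solutions\<close>

text \<open>Curves are functions on \<open>real\<close> of which only the values on \<open>{0..}\<close> matter; derivatives at \<open>0\<close> are
  one-sided.\<close>

definition continuous_curve_V :: "'h::real_inner set \<Rightarrow> ('h \<Rightarrow> 'h) \<Rightarrow> (real \<Rightarrow> 'h) \<Rightarrow> bool" where
  "continuous_curve_V V S u \<longleftrightarrow> (\<forall>t\<ge>0. u t \<in> V) \<and>
     (\<forall>t\<ge>0. ((\<lambda>s. norm_V S (u s - u t)) \<longlongrightarrow> 0) (at t within {0..}))"

definition C1_curve_H :: "(real \<Rightarrow> 'h::real_inner) \<Rightarrow> (real \<Rightarrow> 'h) \<Rightarrow> bool" where
  "C1_curve_H u u' \<longleftrightarrow> (\<forall>t\<ge>0. (u has_vector_derivative u' t) (at t within {0..})) \<and>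
     continuous_on {0..} u'"

definition C1_curve_dual ::
  "'h::real_inner set \<Rightarrow> ('h \<Rightarrow> 'h) \<Rightarrow> (real \<Rightarrow> 'h \<Rightarrow> real) \<Rightarrow> (real \<Rightarrow> 'h \<Rightarrow> real) \<Rightarrow> bool" where
  "C1_curve_dual V S F F' \<longleftrightarrow> (\<forall>t\<ge>0. F t \<in> dual_V V S \<and> F' t \<in> dual_V V S) \<and>
     (\<forall>t\<ge>0. ((\<lambda>s. norm_dual V S (\<lambda>\<phi>. (F s \<phi> - F t \<phi>) / (s - t) - F' t \<phi>)) \<longlongrightarrow> 0)
        (at t within {0..})) \<and>
     (\<forall>t\<ge>0. ((\<lambda>s. norm_dual V S (\<lambda>\<phi>. F' s \<phi> - F' t \<phi>)) \<longlongrightarrow> 0) (at t within {0..}))"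

text \<open>The derivatives \<open>u'\<close> and \<open>v'\<close>, determined on \<open>{0..}\<close> by \<open>u\<close> and \<open>v\<close>, are arguments of the
  predicate.\<close>

definition weak_solution ::
  "'h::real_inner set \<Rightarrow> ('h \<Rightarrow> 'h) \<Rightarrow> real \<Rightarrow>
   (real \<Rightarrow> 'h) \<Rightarrow> (real \<Rightarrow> 'h) \<Rightarrow> (real \<Rightarrow> 'h) \<Rightarrow> (real \<Rightarrow> 'h) \<Rightarrow> bool" where
  "weak_solution V S c u v u' v' \<longleftrightarrow>
     continuous_curve_V V S u \<and> continuous_curve_V V S v \<and>
     C1_curve_H u u' \<and> C1_curve_H v v' \<and>
     (\<exists>u'' v''.
        C1_curve_dual V S (\<lambda>t. pivot (u' t)) u'' \<and> C1_curve_dual V S (\<lambda>t. pivot (v' t)) v'' \<and>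
        (\<forall>t\<ge>0. \<forall>\<phi>\<in>V.
           u'' t \<phi> + pivot (u' t) \<phi> + ext_op S (u t) \<phi> + c * pivot (v t) \<phi> = 0 \<and>
           v'' t \<phi> + ext_op S (v t) \<phi> + c * pivot (u t) \<phi> = 0))"


section \<open>The energy and its perturbation\<close>

definition energy :: "('h::real_inner \<Rightarrow> 'h) \<Rightarrow> real \<Rightarrow> 'h \<Rightarrow> 'h \<Rightarrow> 'h \<Rightarrow> 'h \<Rightarrow> real" where
  "energy S c u v w z =
     1/2 * ((norm_V S u)\<^sup>2 + (norm_V S v)\<^sup>2 + (norm w)\<^sup>2 + (norm z)\<^sup>2) + c * (u \<bullet> v)"

definition H_form ::
  "'h::real_inner set \<Rightarrow> ('h \<Rightarrow> 'h) \<Rightarrow> real \<Rightarrow> real \<Rightarrow> real \<Rightarrow> real \<Rightarrow> 'h \<Rightarrow> 'h \<Rightarrow> 'h \<Rightarrow> 'h \<Rightarrow> real" where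
  "H_form V S lambda1 c p \<epsilon> u v w z =
     (let \<rho> = (p + 1) * lambda1 / (2 * c) in
        energy S c u v w z - \<epsilon> * lambda1 * inner_dual V S (pivot v) (pivot z)
        + p * \<epsilon> * (u \<bullet> w) + \<rho> * \<epsilon> * (w \<bullet> v - u \<bullet> z))"

end

theory Submission
  imports Defs
begin

text \<open>Let \<open>T = A\<^sup>-\<^sup>1\<^sup>/\<^sup>2\<close>, a bounded symmetric operator on \<open>H\<close>, since \<open>0\<close> lies below the spectrum. In terms of
  the continuous curves \<open>U = A\<^sup>1\<^sup>/\<^sup>2 u\<close>, \<open>Y = A\<^sup>1\<^sup>/\<^sup>2 v\<close>, \<open>u'\<close>, \<open>v'\<close> in \<open>H\<close>, a weak solution satisfies
  \<open>(T U)' = u'\<close>, \<open>(T Y)' = v'\<close>, \<open>(T u')' = - (T u' + U + c T\<^sup>2 Y)\<close>, \<open>(T v')' = - (Y + c T\<^sup>2 U)\<close> in \<open>H\<close>.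
  The terms of order \<open>\<epsilon>\<close> in \<open>H\<^sub>\<epsilon>\<close> carry a factor \<open>T\<close>, so they can be differentiated directly.
  The energy cannot: one regularises by \<open>n (A + n)\<^sup>-\<^sup>1\<close>, which factors through \<open>T\<close>, and passes to the
  limit in the integrated identity, which gives \<open>E' = - |u'|\<^sup>2\<close> because \<open>u'\<close> is continuous.
  The constant \<open>\<rho>\<close> is chosen such that, after \<open>\<parallel>u\<parallel>\<^sup>2 \<ge> \<lambda>\<^sub>1 |u|\<^sup>2\<close>, both \<open>|u|\<^sup>2\<close> and \<open>|v|\<^sup>2\<close> get the
  coefficient \<open>- \<epsilon> \<lambda>\<^sub>1 (p - 1) / 2\<close> in the derivative. The cross terms are bounded by \<open>\<epsilon> |c| (p + 1) |u| |v|\<close>, which the condition on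
  \<open>p\<close> absorbs, and those containing \<open>u'\<close> are absorbed by \<open>- |u'|\<^sup>2\<close> for small \<open>\<epsilon>\<close>.\<close>

section \<open>The inverse square root\<close>

lemma linear_op_diff:
  assumes "linear_op D A" "x \<in> D" "y \<in> D"
  shows "x - y \<in> D" "A (x - y) = A x - A y"
proof -
  show D: "x - y \<in> D"
    using assms by (simp add: linear_op_def subspace_diff)
  have "A ((x - y) + y) = A (x - y) + A y"
    using assms D unfolding linear_op_def by blast
  then show "A (x - y) = A x - A y"
    by simp
qed

lemma self_adjoint_symmetric:
  assumes "self_adjoint D A" "x \<in> D" "y \<in> D"
  shows "A x \<bullet> y = x \<bullet> A y"
proof -
  have "(y, A y) \<in> adjoint_graph D A"
    using assms by (auto simp: self_adjoint_def op_graph_def)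
  then show ?thesis
    using assms by (auto simp: adjoint_graph_def)
qed

text \<open>If \<open>A - m\<close> is positive and has a bounded inverse, then testing positivity at
  \<open>x - K\<^sup>-\<^sup>1 (A - m)\<^sup>-\<^sup>1 x\<close> shows that \<open>A - m - K\<^sup>-\<^sup>1\<close> is positive as well, so the bottom of the numerical
  range is never in the resolvent set.\<close>

lemma resolvent_improves_lower_bound:
  assumes sa: "self_adjoint D A" and res: "m \<in> resolvent_set D A"
    and lb: "\<And>x. x \<in> D \<Longrightarrow> m * (norm x)\<^sup>2 \<le> A x \<bullet> x"
  shows "\<exists>\<delta>>0. \<forall>x\<in>D. (m + \<delta>) * (norm x)\<^sup>2 \<le> A x \<bullet> x"
proof -
  have lin: "linear_op D A"
    using sa by (simp add: self_adjoint_def)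
  obtain K0 where bij: "bij_betw (\<lambda>x. A x - m *\<^sub>R x) D UNIV"
    and K0: "\<And>x. x \<in> D \<Longrightarrow> norm x \<le> K0 * norm (A x - m *\<^sub>R x)"
    using res unfolding resolvent_set_def by auto
  \<comment> \<open>The maximum with 1 makes \<open>K\<close> positive, since a resolvent bound
    \<open>K0\<close> need not be.\<close>
  define K where "K = max K0 1"
  have K: "K > 0"
    by (simp add: K_def)
  have "(m + 1 / K) * (norm x)\<^sup>2 \<le> A x \<bullet> x" if x: "x \<in> D" for x
  proof -
    have "x \<in> (\<lambda>y. A y - m *\<^sub>R y) ` D"
      using bij by (simp add: bij_betw_def)
    then obtain y where y: "y \<in> D" "A y - m *\<^sub>R y = x"
      by blast
    have "norm y \<le> K0 * norm x"
      using K0 y by blast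
    also have "\<dots> \<le> K * norm x"
      by (intro mult_right_mono) (auto simp: K_def)
    finally have yK: "norm y \<le> K * norm x" .
    have "x \<bullet> y \<le> norm x * norm y"
      by (rule norm_cauchy_schwarz)
    also have "\<dots> \<le> norm x * (K * norm x)"
      using yK by (intro mult_left_mono) auto
    finally have xy: "x \<bullet> y \<le> K * (x \<bullet> x)"
      by (simp add: power2_norm_eq_inner[symmetric] power2_eq_square mult_ac)
    define z where "z = x - (1 / K) *\<^sub>R y"
    have yD: "(1 / K) *\<^sub>R y \<in> D" "A ((1 / K) *\<^sub>R y) = (1 / K) *\<^sub>R A y"
      using lin y by (auto simp: linear_op_def subspace_scale)
    have z: "z \<in> D" "A z = A x - (1 / K) *\<^sub>R A y"
      using linear_op_diff[OF lin x yD(1)] yD(2) by (auto simp: z_def)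
    have Ay: "A y = x + m *\<^sub>R y"
      using y by (simp add: algebra_simps)
    have Axy: "A x \<bullet> y = x \<bullet> x + m * (x \<bullet> y)"
      using self_adjoint_symmetric[OF sa x y(1)] Ay by (simp add: inner_right_distrib)
    have "0 \<le> A z \<bullet> z - m * (z \<bullet> z)"
      using lb[OF z(1)] by (simp add: power2_norm_eq_inner)
    \<comment> \<open>As \<open>(A - m) y = x\<close>, the mixed terms contribute -2/K times the
      square of |x|, and the term quadratic in \<open>y\<close> is
      \<open>(x \<bullet> y) / K\<^sup>2\<close>, which \<open>xy\<close> bounds by 1/K times that
      square. The net gain is 1/K.\<close>
    also have "\<dots> = A x \<bullet> x - m * (x \<bullet> x) - 2 / K * (x \<bullet> x) + (x \<bullet> y) / K\<^sup>2"
      unfolding z(2) Ay unfolding z_def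
      by (simp add: inner_diff_left inner_diff_right inner_add_left Axy
          inner_commute[of y x] power2_eq_square) (use K in \<open>simp add: field_simps\<close>)
    also have "\<dots> \<le> A x \<bullet> x - m * (x \<bullet> x) - 2 / K * (x \<bullet> x) + K * (x \<bullet> x) / K\<^sup>2"
      using xy by (intro add_left_mono divide_right_mono) auto
    also have "\<dots> = A x \<bullet> x - (m + 1 / K) * (norm x)\<^sup>2"
      using K unfolding power2_norm_eq_inner by (simp add: power2_eq_square field_simps)
    finally show ?thesis
      by simp
  qed
  then show ?thesis
    using K by (intro exI[of _ "1 / K"]) auto
qed

text \<open>A point violating the bound keeps all lower bounds of the form below \<open>l\<close>.
  Their supremum is itself a lower bound, lies below the spectrum, hence in the resolvent set, and
  so could be improved, a contradiction.\<close>

lemma smallest_spectral_value_le_form: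
  assumes sa: "self_adjoint D A" and pos: "positive_op D A"
    and sp: "smallest_spectral_value D A l" and x: "x \<in> D"
  shows "l * (norm x)\<^sup>2 \<le> A x \<bullet> x"
proof (rule ccontr)
  assume less: "\<not> ?thesis"
  define Q where "Q = {\<mu>. \<forall>y\<in>D. \<mu> * (norm y)\<^sup>2 \<le> A y \<bullet> y}"
  have Q_lt: "\<mu> < l" if "\<mu> \<in> Q" for \<mu>
  proof -
    have "\<mu> * (norm x)\<^sup>2 < l * (norm x)\<^sup>2"
      using that x less by (force simp: Q_def)
    then show ?thesis
      by (simp add: mult_less_cancel_right)
  qed
  have Q0: "0 \<in> Q"
    using pos by (auto simp: Q_def positive_op_def)
  have bdd: "bdd_above Q"
    using Q_lt by (meson bdd_aboveI less_imp_le)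
  have "closed Q"
  proof -
    have "Q = (\<Inter>y\<in>D. {\<mu>. \<mu> * (norm y)\<^sup>2 \<le> A y \<bullet> y})"
      by (auto simp: Q_def)
    then show ?thesis
      by (auto intro!: closed_INT closed_Collect_le continuous_intros)
  qed
  then have m: "Sup Q \<in> Q"
    using Q0 bdd by (intro closed_contains_Sup) auto
  then have "Sup Q \<in> resolvent_set D A"
    using sp Q_lt by (force simp: smallest_spectral_value_def spectrum_def)
  from resolvent_improves_lower_bound[OF sa this] m
  obtain \<delta> where "\<delta> > 0" "Sup Q + \<delta> \<in> Q"
    by (auto simp: Q_def)
  then show False
    using cSup_upper[OF _ bdd] by fastforce
qed

text \<open>The facts about \<open>T\<close>, the inverse of \<open>S\<close>, on which the calculus
  along solutions rests. \<open>T_bound\<close> at \<open>S u\<close> is the inequality between the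
  norms of \<open>V\<close> and \<open>H\<close>.\<close>

locale bounded_inverse_root =
  fixes V :: "'h::real_inner set" and S T :: "'h \<Rightarrow> 'h" and l :: real
  assumes T_linear: "bounded_linear T"
    and T_symmetric: "T x \<bullet> y = x \<bullet> T y"
    and T_in: "T x \<in> V"
    and S_T: "S (T x) = x"
    and T_S: "x \<in> V \<Longrightarrow> T (S x) = x"
    and l_pos: "l > 0"
    and T_bound: "l * (norm (T x))\<^sup>2 \<le> (norm x)\<^sup>2"

text \<open>Since \<open>l > 0\<close>, the operator \<open>A\<close> is bijective from
  \<open>D\<close>, and \<open>S\<close> inherits this as its square root: \<open>S x = S y\<close>
  puts \<open>x - y\<close> in the kernel of \<open>A\<close>, and \<open>h = A x\<close> is the
  image of \<open>S x\<close> under \<open>S\<close>.\<close>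

lemma bounded_inverse_root_exists:
  assumes sa: "self_adjoint D A" and pos: "positive_op D A" and sqrt: "is_sqrt_op D A V S"
    and sp: "smallest_spectral_value D A l" and l: "l > 0"
  shows "bounded_inverse_root V S (inv_into V S) l"
proof -
  define T where "T = inv_into V S"
  have saS: "self_adjoint V S"
    and DV: "D = {x \<in> V. S x \<in> V}" and A_S: "\<And>x. x \<in> D \<Longrightarrow> A x = S (S x)"
    using sqrt by (auto simp: is_sqrt_op_def)
  have linS: "linear_op V S" and linA: "linear_op D A"
    using saS sa by (auto simp: self_adjoint_def)
  note diffS = linear_op_diff[OF linS] and diffA = linear_op_diff[OF linA]
  have zero: "0 \<in> V" "S 0 = 0" "0 \<in> D" "A 0 = 0"
    using diffS[of 0 0] diffA[of 0 0] linS linA by (auto simp: linear_op_def subspace_0)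
  have "0 \<in> resolvent_set D A"
    using sp l by (force simp: smallest_spectral_value_def spectrum_def)
  then have bij: "bij_betw A D UNIV"
    by (simp add: resolvent_set_def)
  have injS: "x = y" if "x \<in> V" "y \<in> V" "S x = S y" for x y
  proof -
    have "x - y \<in> D" "A (x - y) = A 0"
      using diffS[of x y] that zero DV A_S by auto
    then have "x - y = 0"
      using bij zero by (metis bij_betw_imp_inj_on inj_onD)
    then show ?thesis
      by simp
  qed
  then have inj: "inj_on S V"
    by (auto intro: inj_onI)
  have surj: "S ` V = UNIV"
  proof (intro equalityI subset_UNIV subsetI)
    fix h
    obtain x where "x \<in> D" "A x = h"
      using bij by (metis UNIV_I bij_betw_imp_surj_on imageE)
    then show "h \<in> S ` V"
      using DV A_S by (metis (mono_tags, lifting) imageI mem_Collect_eq)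
  qed
  have T_in: "T x \<in> V" and S_T: "S (T x) = x" for x
    using surj by (auto simp: T_def inv_into_into f_inv_into_f)
  have T_S: "T (S x) = x" if "x \<in> V" for x
    using inj that by (simp add: T_def)
  have sym: "T x \<bullet> y = x \<bullet> T y" for x y
    using self_adjoint_symmetric[OF saS T_in[of x] T_in[of y]] by (simp add: S_T)
  have TT: "T (T x) \<in> D" "A (T (T x)) = x" for x
    using DV A_S T_in S_T by auto
  \<comment> \<open>The form inequality is known on \<open>D\<close> only. It is therefore applied
    to \<open>T (T x)\<close>, and the bound on \<open>T\<close> follows because the square of |T x|
    equals \<open>x \<bullet> T (T x)\<close>.\<close>
  have norm_TT: "l * norm (T (T x)) \<le> norm x" for x
  proof (cases "T (T x) = 0")
    case False
    have "l * (norm (T (T x)))\<^sup>2 \<le> x \<bullet> T (T x)"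
      using smallest_spectral_value_le_form[OF sa pos sp TT(1)] by (simp add: TT(2))
    also have "\<dots> \<le> norm x * norm (T (T x))"
      by (rule norm_cauchy_schwarz)
    finally show ?thesis
      using False by (simp add: power2_eq_square)
  qed simp
  have bound: "l * (norm (T x))\<^sup>2 \<le> (norm x)\<^sup>2" for x
  proof -
    have "l * (norm (T x))\<^sup>2 = l * (x \<bullet> T (T x))"
      by (simp add: power2_norm_eq_inner sym)
    also have "\<dots> \<le> l * (norm x * norm (T (T x)))"
      using l by (intro mult_left_mono norm_cauchy_schwarz) auto
    also have "\<dots> = norm x * (l * norm (T (T x)))"
      by simp
    also have "\<dots> \<le> norm x * norm x"
      by (intro mult_left_mono norm_TT) auto
    finally show ?thesis
      by (simp add: power2_eq_square)
  qed
  have "bounded_linear T"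
  proof (rule bounded_linear_intro)
    have V_add: "x + y \<in> V" "S (x + y) = S x + S y" if "x \<in> V" "y \<in> V" for x y
      using linS that by (auto simp: linear_op_def subspace_add)
    have V_scale: "r *\<^sub>R x \<in> V" "S (r *\<^sub>R x) = r *\<^sub>R S x" if "x \<in> V" for r x
      using linS that by (auto simp: linear_op_def subspace_scale)
    show "T (x + y) = T x + T y" for x y
      by (rule injS) (auto simp: V_add T_in S_T)
    show "T (r *\<^sub>R x) = r *\<^sub>R T x" for r x
      by (rule injS) (auto simp: V_scale T_in S_T)
    show "norm (T x) \<le> norm x * (1 / sqrt l)" for x
    proof -
      have "(sqrt l * norm (T x))\<^sup>2 \<le> (norm x)\<^sup>2"
        using bound[of x] l by (simp add: power_mult_distrib)
      then have "sqrt l * norm (T x) \<le> norm x"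
        by (rule power2_le_imp_le) simp
      then show ?thesis
        using l by (simp add: field_simps)
    qed
  qed
  then show ?thesis
    unfolding T_def[symmetric]
    by (rule bounded_inverse_root.intro) (use T_in S_T T_S sym l bound in auto)
qed

section \<open>Linearity of \<open>T\<close> and of \<open>S\<close> on \<open>V\<close>\<close>

context bounded_inverse_root
begin

lemma T_add: "T (x + y) = T x + T y"
  by (rule bounded_linear.linear[OF T_linear, THEN linear_add])

lemma T_diff: "T (x - y) = T x - T y"
  by (rule bounded_linear.linear[OF T_linear, THEN linear_diff])

lemma T_scale: "T (r *\<^sub>R x) = r *\<^sub>R T x"
  by (rule bounded_linear.linear[OF T_linear, THEN linear_scale])

lemma S_add: "x \<in> V \<Longrightarrow> y \<in> V \<Longrightarrow> S (x + y) = S x + S y"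
  by (metis T_add S_T T_S)

lemma S_diff: "x \<in> V \<Longrightarrow> y \<in> V \<Longrightarrow> S (x - y) = S x - S y"
  by (metis T_diff S_T T_S)

lemma S_scale: "x \<in> V \<Longrightarrow> S (r *\<^sub>R x) = r *\<^sub>R S x"
  by (metis T_scale S_T T_S)

end

text \<open>The regularisers are \<open>T Q\<^sub>n = n (A + n)\<^sup>-\<^sup>1\<close>.\<close>

lemma regularisers_exist:
  assumes sa: "self_adjoint D A" and pos: "positive_op D A" and sqrt: "is_sqrt_op D A V S"
    and sp: "smallest_spectral_value D A l" and T: "bounded_inverse_root V S T l"
  shows "\<exists>Q :: nat \<Rightarrow> 'h::real_inner \<Rightarrow> 'h. (\<forall>n. bounded_linear (Q n)) \<and>
    (\<forall>n x. T (Q n x) = Q n (T x)) \<and> (\<forall>n x. norm (T (Q n x)) \<le> norm x) \<and>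
    (\<forall>x. (\<lambda>n. T (Q n x)) \<longlonglongrightarrow> x)"
proof -
  interpret bounded_inverse_root V S T l
    by (rule T)
  have DV: "D = {x \<in> V. S x \<in> V}" and A_S: "\<And>x. x \<in> D \<Longrightarrow> A x = S (S x)"
    using sqrt by (auto simp: is_sqrt_op_def)
  have linA: "linear_op D A" and dense: "closure D = UNIV"
    using sa by (auto simp: self_adjoint_def)
  have D_add: "x + y \<in> D" "A (x + y) = A x + A y" if "x \<in> D" "y \<in> D" for x y
    using linA that by (auto simp: linear_op_def subspace_add)
  have D_scale: "r *\<^sub>R x \<in> D" "A (r *\<^sub>R x) = r *\<^sub>R A x" if "x \<in> D" for r x
    using linA that by (auto simp: linear_op_def subspace_scale)
  \<comment> \<open>The shift by one keeps \<open>k n\<close> positive at every index, so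
    \<open>- k n\<close> lies below the spectrum and division by \<open>k n\<close> is
    legitimate.\<close>
  define k :: "nat \<Rightarrow> real" where "k n = real (Suc n)" for n
  have k: "k n > 0" for n
    by (simp add: k_def)
  define R where "R n = inv_into D (\<lambda>x. A x + k n *\<^sub>R x)" for n
  have bij: "bij_betw (\<lambda>x. A x + k n *\<^sub>R x) D UNIV" for n
  proof -
    have "- k n \<in> resolvent_set D A"
      using sp l_pos k[of n] by (force simp: smallest_spectral_value_def spectrum_def)
    then show ?thesis
      by (simp add: resolvent_set_def)
  qed
  have R_in: "R n x \<in> D" and R_eq: "A (R n x) = x - k n *\<^sub>R R n x" for n x
  proof -
    have im: "x \<in> (\<lambda>x. A x + k n *\<^sub>R x) ` D"
      using bij[of n] by (auto simp: bij_betw_def)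
    show "R n x \<in> D"
      unfolding R_def by (rule inv_into_into[OF im])
    show "A (R n x) = x - k n *\<^sub>R R n x"
      using f_inv_into_f[OF im] by (simp add: R_def algebra_simps)
  qed
  have R_unique: "R n x = y" if "y \<in> D" "A y + k n *\<^sub>R y = x" for n x y
    using that bij[of n] unfolding R_def bij_betw_def by (auto intro: inv_into_f_eq)
  have R_V: "R n x \<in> V" "S (R n x) \<in> V" for n x
    using R_in[of n x] DV by auto
  have R_form: "0 \<le> A (R n x) \<bullet> R n x" for n x
    using pos R_in by (auto simp: positive_op_def)
  have R_norm: "k n * norm (R n x) \<le> norm x" for n x
  proof (cases "R n x = 0")
    case False
    have "k n * (norm (R n x))\<^sup>2 \<le> x \<bullet> R n x"
      using R_form[of n x] by (simp add: R_eq inner_diff_left power2_norm_eq_inner)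
    also have "\<dots> \<le> norm x * norm (R n x)"
      by (rule norm_cauchy_schwarz)
    finally show ?thesis
      using False by (simp add: power2_eq_square)
  qed simp
  have R_add: "R n (x + y) = R n x + R n y" for n x y
    by (rule R_unique) (auto simp: D_add R_in R_eq algebra_simps)
  have R_scale: "R n (r *\<^sub>R x) = r *\<^sub>R R n x" for n r x
    by (rule R_unique) (auto simp: D_scale R_in R_eq algebra_simps)
  have R_T: "R n (T x) = T (R n x)" for n x
  proof (rule R_unique)
    show D: "T (R n x) \<in> D"
      using DV T_in S_T R_V by auto
    have "A (T (R n x)) = T (A (R n x))"
      using D R_in R_V by (simp add: A_S S_T T_S)
    then show "A (T (R n x)) + k n *\<^sub>R T (R n x) = T x"
      by (simp add: R_eq T_diff T_scale)
  qed
  \<comment> \<open>The resolvent maps into \<open>D\<close>, which is contained in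
    \<open>V\<close>, so \<open>S\<close> may be applied to it. This leaves one factor
    \<open>T\<close> to be absorbed: both \<open>T (Q n x)\<close> and \<open>Q n (T x)\<close> are
    \<open>k n *\<^sub>R R n x\<close>.\<close>
  define Q where "Q n x = k n *\<^sub>R S (R n x)" for n x
  have TQ: "T (Q n x) = k n *\<^sub>R R n x" for n x
    using R_V by (simp add: Q_def T_scale T_S)
  have QT: "Q n (T x) = k n *\<^sub>R R n x" for n x
    by (simp add: Q_def R_T S_T)
  \<comment> \<open>This makes each \<open>Q n\<close> bounded, with a bound growing like the square
    root of \<open>k n\<close>. Only \<open>T (Q n x)\<close> is bounded uniformly in
    \<open>n\<close>.\<close>
  have SR_norm: "(norm (S (R n x)))\<^sup>2 \<le> (norm x)\<^sup>2 / k n" for n x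
  proof -
    have saS: "self_adjoint V S"
      using sqrt by (simp add: is_sqrt_op_def)
    have "(norm (S (R n x)))\<^sup>2 = A (R n x) \<bullet> R n x"
      using self_adjoint_symmetric[OF saS R_V(1) R_V(2)] R_in
      by (simp add: A_S power2_norm_eq_inner inner_commute)
    also have "\<dots> \<le> x \<bullet> R n x"
      using k[of n] by (simp add: R_eq inner_diff_left)
    also have "\<dots> \<le> norm x * norm (R n x)"
      by (rule norm_cauchy_schwarz)
    also have "\<dots> \<le> norm x * (norm x / k n)"
      using R_norm[of n x] k[of n] by (intro mult_left_mono) (auto simp: field_simps)
    finally show ?thesis
      by (simp add: power2_eq_square)
  qed
  have "bounded_linear (Q n)" for n
  proof (rule bounded_linear_intro)
    show "Q n (x + y) = Q n x + Q n y" for x y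
      by (simp add: Q_def R_add S_add R_V scaleR_add_right)
    show "Q n (r *\<^sub>R x) = r *\<^sub>R Q n x" for r x
      by (simp add: Q_def R_scale S_scale R_V)
    show "norm (Q n x) \<le> norm x * sqrt (k n)" for x
    proof (rule power2_le_imp_le)
      have "(norm (Q n x))\<^sup>2 = (k n)\<^sup>2 * (norm (S (R n x)))\<^sup>2"
        by (simp add: Q_def power_mult_distrib)
      also have "\<dots> \<le> (k n)\<^sup>2 * ((norm x)\<^sup>2 / k n)"
        by (intro mult_left_mono SR_norm) auto
      finally show "(norm (Q n x))\<^sup>2 \<le> (norm x * sqrt (k n))\<^sup>2"
        using k[of n] by (simp add: power_mult_distrib power2_eq_square mult_ac)
    qed (use k[of n] in auto)
  qed
  moreover have TQ_norm: "norm (T (Q n x)) \<le> norm x" for n x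
    using R_norm[of n x] k[of n] by (simp add: TQ)
  moreover have "(\<lambda>n. T (Q n x)) \<longlonglongrightarrow> x" for x
  proof (rule LIMSEQ_I)
    fix e :: real assume e: "e > 0"
    have "x \<in> closure D"
      by (simp add: dense)
    then obtain y where y: "y \<in> D" "dist y x < e / 3"
      using e closure_approachable by (metis divide_pos_pos zero_less_numeral)
    obtain N where N: "norm (A y) / (e / 3) < real N"
      using reals_Archimedean2 by blast
    have "norm (T (Q n x) - x) < e" if n: "n \<ge> N" for n
    proof -
      \<comment> \<open>On \<open>D\<close> the error is a resolvent applied to \<open>A y\<close>,
        hence of order \<open>1 / k n\<close>. Density of \<open>D\<close> and the uniform bound
        carry the convergence to all of \<open>H\<close>.\<close>
      have Ry: "R n (A y) = y - T (Q n y)"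
      proof (rule R_unique)
        show "y - T (Q n y) \<in> D"
          unfolding TQ by (intro linear_op_diff(1)[OF linA] y D_scale R_in)
        show "A (y - T (Q n y)) + k n *\<^sub>R (y - T (Q n y)) = A y"
          unfolding TQ
          by (simp add: linear_op_diff(2)[OF linA] y D_scale R_in R_eq algebra_simps)
      qed
      have "k n * norm (y - T (Q n y)) \<le> norm (A y)"
        using R_norm[of n "A y"] by (simp add: Ry)
      also have "\<dots> < (e / 3) * real N"
        using N e by (simp add: field_simps)
      also have "\<dots> \<le> (e / 3) * k n"
        using n e by (intro mult_left_mono) (auto simp: k_def)
      finally have 1: "norm (y - T (Q n y)) < e / 3"
        using k[of n] by (simp add: mult.commute)
      have "T (Q n x) - T (Q n y) = T (Q n (x - y))"
        using \<open>bounded_linear (Q n)\<close>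
        by (simp add: T_diff linear_diff[OF bounded_linear.linear])
      then have 2: "norm (T (Q n x) - T (Q n y)) < e / 3"
        using TQ_norm[of n "x - y"] y(2) by (simp add: dist_norm norm_minus_commute)
      have "norm (T (Q n x) - x) = norm ((T (Q n x) - T (Q n y)) - (y - T (Q n y)) + (y - x))"
        by (simp add: algebra_simps)
      also have "\<dots> \<le> norm (T (Q n x) - T (Q n y)) + norm (y - T (Q n y)) + norm (y - x)"
        by (meson add_right_mono norm_triangle_ineq norm_triangle_ineq4 order_trans)
      finally show ?thesis
        using 1 2 y(2) by (simp add: dist_norm)
    qed
    then show "\<exists>N. \<forall>n\<ge>N. norm (T (Q n x) - x) < e"
      by blast
  qed
  ultimately show ?thesis
    by (intro exI[of _ Q]) (auto simp: TQ QT)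
qed

section \<open>The energy identity\<close>

text \<open>The quotient form matches the way derivatives in \<open>V'\<close> are defined, and
  suits product rules in which \<open>T\<close> is moved between the factors.\<close>

lemma has_vector_derivative_iff_quotient:
  "(f has_vector_derivative d) (at t within I) \<longleftrightarrow>
    ((\<lambda>s. (1 / (s - t)) *\<^sub>R (f s - f t)) \<longlongrightarrow> d) (at t within I)"
proof -
  have eq: "norm (f s - f t - (s - t) *\<^sub>R d) / \<bar>s - t\<bar> = norm ((1 / (s - t)) *\<^sub>R (f s - f t) - d)"
    if "s \<noteq> t" for s
  proof -
    have "(1 / (s - t)) *\<^sub>R (f s - f t) - d = (1 / (s - t)) *\<^sub>R (f s - f t - (s - t) *\<^sub>R d)"
      using that by (simp add: scaleR_diff_right)
    then show ?thesis
      by (simp add: divide_inverse_commute)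
  qed
  have "(f has_vector_derivative d) (at t within I) \<longleftrightarrow>
      ((\<lambda>s. norm (f s - f t - (s - t) *\<^sub>R d) / norm (s - t)) \<longlongrightarrow> 0) (at t within I)"
    by (simp add: has_vector_derivative_def has_derivative_iff_norm bounded_linear_scaleR_left)
  also have "\<dots> \<longleftrightarrow>
      ((\<lambda>s. norm ((1 / (s - t)) *\<^sub>R (f s - f t) - d)) \<longlongrightarrow> 0) (at t within I)"
    by (intro tendsto_cong) (auto simp: eventually_at_filter intro!: always_eventually eq)
  also have "\<dots> \<longleftrightarrow> ((\<lambda>s. (1 / (s - t)) *\<^sub>R (f s - f t)) \<longlongrightarrow> d) (at t within I)"
    by (simp only: tendsto_norm_zero_iff LIM_zero_iff)
  finally show ?thesis .
qed

context bounded_inverse_root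
begin

text \<open>Symmetry of \<open>T\<close> splits the increment of \<open>T X \<bullet> Y\<close> into
  \<open>X s\<close> against the increment of \<open>T Y\<close> and the increment of
  \<open>T X\<close> against \<open>Y t\<close>. No difference quotient of \<open>X\<close> or
  \<open>Y\<close> itself appears.\<close>

lemma has_real_derivative_T_inner:
  assumes X: "continuous (at t within I) X"
    and dX: "((\<lambda>s. T (X s)) has_vector_derivative a) (at t within I)"
    and dY: "((\<lambda>s. T (Y s)) has_vector_derivative b) (at t within I)"
  shows "((\<lambda>s. T (X s) \<bullet> Y s) has_real_derivative X t \<bullet> b + a \<bullet> Y t) (at t within I)"
proof -
  let ?q = "\<lambda>f s. (1 / (s - t)) *\<^sub>R (f s - f t)"
  have "((\<lambda>s. X s \<bullet> ?q (\<lambda>s. T (Y s)) s + ?q (\<lambda>s. T (X s)) s \<bullet> Y t) \<longlongrightarrow> X t \<bullet> b + a \<bullet> Y t)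
      (at t within I)"
    using X dX dY unfolding has_vector_derivative_iff_quotient continuous_within
    by (intro tendsto_add tendsto_inner tendsto_const)
  moreover have "X s \<bullet> ?q (\<lambda>s. T (Y s)) s + ?q (\<lambda>s. T (X s)) s \<bullet> Y t =
      (T (X s) \<bullet> Y s - T (X t) \<bullet> Y t) / (s - t)" for s
    by (simp add: inner_diff_left inner_diff_right T_symmetric diff_divide_distrib)
  ultimately show ?thesis
    by (simp add: has_field_derivative_iff)
qed

end

lemma has_real_derivative_inner:
  assumes "(f has_vector_derivative f') (at t within I)" "(g has_vector_derivative g') (at t within I)"
  shows "((\<lambda>s. f s \<bullet> g s) has_real_derivative f t \<bullet> g' + f' \<bullet> g t) (at t within I)"
  using bounded_bilinear.has_vector_derivative[OF bounded_bilinear_inner assms]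
  by (simp add: has_real_derivative_iff_has_vector_derivative)

context bounded_inverse_root
begin

text \<open>Since \<open>J X = Q (T X)\<close>, the regularised curves are differentiable in
  \<open>H\<close>. The stiffness terms cancel by symmetry of \<open>T\<close>, the coupling terms
  cancel against the derivative of the term with factor \<open>c\<close>, and only the damping
  survives.\<close>

lemma regularised_energy_derivative:
  assumes Q: "bounded_linear Q" and QT: "\<And>x. T (Q x) = Q (T x)"
    and dU: "((\<lambda>s. T (U s)) has_vector_derivative W t) (at t within I)"
    and dY: "((\<lambda>s. T (Y s)) has_vector_derivative Z t) (at t within I)"
    and dW: "((\<lambda>s. T (W s)) has_vector_derivative - (T (W t) + U t + c *\<^sub>R T (T (Y t))))
      (at t within I)"
    and dZ: "((\<lambda>s. T (Z s)) has_vector_derivative - (Y t + c *\<^sub>R T (T (U t)))) (at t within I)"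
  defines "J \<equiv> \<lambda>x. T (Q x)"
  shows "((\<lambda>s. 1/2 * (J (U s) \<bullet> J (U s) + J (Y s) \<bullet> J (Y s) + J (W s) \<bullet> J (W s) + J (Z s) \<bullet> J (Z s))
      + c * (J (T (U s)) \<bullet> J (T (Y s)))) has_real_derivative - (norm (J (W t)))\<^sup>2) (at t within I)"
proof -
  have J: "((\<lambda>s. J (X s)) has_vector_derivative Q d) (at t within I)"
    if "((\<lambda>s. T (X s)) has_vector_derivative d) (at t within I)" for X d
    using bounded_linear.has_vector_derivative[OF Q that] by (simp add: J_def QT)
  have JT: "((\<lambda>s. J (T (X s))) has_vector_derivative J d) (at t within I)"
    if "((\<lambda>s. T (X s)) has_vector_derivative d) (at t within I)" for X d
    unfolding J_def
    by (intro bounded_linear.has_vector_derivative[OF T_linear]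
        bounded_linear.has_vector_derivative[OF Q] that)
  note linQ = linear_add[OF bounded_linear.linear[OF Q]] linear_neg[OF bounded_linear.linear[OF Q]]
    linear_scale[OF bounded_linear.linear[OF Q]] linear_diff[OF bounded_linear.linear[OF Q]]
  have sym: "x \<bullet> T y = y \<bullet> T x" for x y
    by (metis T_symmetric inner_commute)
  note intros = has_real_derivative_inner[OF J[OF dU] J[OF dU]] has_real_derivative_inner[OF J[OF dY] J[OF dY]]
    has_real_derivative_inner[OF J[OF dW] J[OF dW]] has_real_derivative_inner[OF J[OF dZ] J[OF dZ]]
    has_real_derivative_inner[OF JT[OF dU] JT[OF dY]]
  define u y w z where "u = Q (U t)" "y = Q (Y t)" "w = Q (W t)" "z = Q (Z t)"
  note defs = u_y_w_z_def
  have "T u \<bullet> w = u \<bullet> T w" "T y \<bullet> z = y \<bullet> T z"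
    by (rule T_symmetric)+
  then show ?thesis
    by - ((rule derivative_eq_intros intros refl)+,
      simp add: J_def QT[symmetric] linQ defs[symmetric] inner_add_left inner_add_right
        inner_diff_left inner_diff_right power2_norm_eq_inner inner_commute algebra_simps)
qed

text \<open>The second derivatives exist only in \<open>V'\<close>, so the regularised identity is
  integrated first. Its right side involves \<open>W\<close> alone, which allows the limit;
  continuity of \<open>W\<close> then restores a pointwise derivative.\<close>

lemma energy_derivative:
  fixes Q :: "nat \<Rightarrow> 'h \<Rightarrow> 'h" and U Y W Z :: "real \<Rightarrow> 'h" and c :: real
  assumes Q: "\<And>n. bounded_linear (Q n)" "\<And>n x. T (Q n x) = Q n (T x)"
    and Q_norm: "\<And>n x. norm (T (Q n x)) \<le> norm x"
    and Q_lim: "\<And>x. (\<lambda>n. T (Q n x)) \<longlonglongrightarrow> x"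
    and W: "continuous_on {0..} W"
    and dU: "\<And>t. t \<ge> 0 \<Longrightarrow> ((\<lambda>s. T (U s)) has_vector_derivative W t) (at t within {0..})"
    and dY: "\<And>t. t \<ge> 0 \<Longrightarrow> ((\<lambda>s. T (Y s)) has_vector_derivative Z t) (at t within {0..})"
    and dW: "\<And>t. t \<ge> 0 \<Longrightarrow> ((\<lambda>s. T (W s)) has_vector_derivative
      - (T (W t) + U t + c *\<^sub>R T (T (Y t)))) (at t within {0..})"
    and dZ: "\<And>t. t \<ge> 0 \<Longrightarrow> ((\<lambda>s. T (Z s)) has_vector_derivative
      - (Y t + c *\<^sub>R T (T (U t)))) (at t within {0..})"
    and t: "t \<ge> 0"
  shows "((\<lambda>s. 1/2 * ((norm (U s))\<^sup>2 + (norm (Y s))\<^sup>2 + (norm (W s))\<^sup>2 + (norm (Z s))\<^sup>2)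
      + c * (T (U s) \<bullet> T (Y s))) has_real_derivative - (norm (W t))\<^sup>2) (at t within {0..})"
proof -
  define E where "E s = 1/2 * ((norm (U s))\<^sup>2 + (norm (Y s))\<^sup>2 + (norm (W s))\<^sup>2 + (norm (Z s))\<^sup>2)
      + c * (T (U s) \<bullet> T (Y s))" for s
  define En where "En n s = (let J = \<lambda>x. T (Q n x) in
      1/2 * (J (U s) \<bullet> J (U s) + J (Y s) \<bullet> J (Y s) + J (W s) \<bullet> J (W s) + J (Z s) \<bullet> J (Z s))
      + c * (J (T (U s)) \<bullet> J (T (Y s))))" for n s
  have dEn: "(En n has_real_derivative - (norm (T (Q n (W s))))\<^sup>2) (at s within {0..})" if "s \<ge> 0" for n s
    unfolding En_def Let_def
    by (rule regularised_energy_derivative) (use Q dU dY dW dZ that in auto)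
  have lim: "(\<lambda>n. En n s) \<longlonglongrightarrow> E s" for s
    unfolding En_def E_def Let_def power2_norm_eq_inner
    by (intro tendsto_intros Q_lim)
  have int: "((\<lambda>s. - (norm (W s))\<^sup>2) has_integral E r - E 0) {0..r}" if r: "r \<ge> 0" for r
  \<comment> \<open>The uniform bound on \<open>T (Q n x)\<close> makes the square of |W| the
    dominating function.\<close>
  proof (rule has_integral_dominated_convergence)
    show "((\<lambda>s. - (norm (T (Q n (W s))))\<^sup>2) has_integral En n r - En n 0) {0..r}" for n
    proof (rule fundamental_theorem_of_calculus[OF r])
      fix s assume "s \<in> {0..r}"
      then show "(En n has_vector_derivative - (norm (T (Q n (W s))))\<^sup>2) (at s within {0..r})"
        using has_vector_derivative_within_subset[of "En n" _ s "{0..}" "{0..r}"] dEn[of s n]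
        by (auto simp: has_real_derivative_iff_has_vector_derivative)
    qed
    show "(\<lambda>s. (norm (W s))\<^sup>2) integrable_on {0..r}"
      by (intro integrable_continuous_real continuous_intros continuous_on_subset[OF W]) auto
    show "\<forall>s\<in>{0..r}. norm (- (norm (T (Q n (W s))))\<^sup>2) \<le> (norm (W s))\<^sup>2" for n
      by (simp add: Q_norm power_mono)
    show "\<forall>s\<in>{0..r}. (\<lambda>n. - (norm (T (Q n (W s))))\<^sup>2) \<longlonglongrightarrow> - (norm (W s))\<^sup>2"
      by (intro ballI tendsto_intros Q_lim)
    show "(\<lambda>n. En n r - En n 0) \<longlonglongrightarrow> E r - E 0"
      by (intro tendsto_intros lim)
  qed
  \<comment> \<open>The interval reaches beyond \<open>t\<close>, so it is a neighbourhood of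
    \<open>t\<close> relative to the half-line, also at \<open>t = 0\<close>.\<close>
  have cont: "continuous_on {0..t + 1} (\<lambda>s. - (norm (W s))\<^sup>2)"
    by (intro continuous_intros continuous_on_subset[OF W]) auto
  have "((\<lambda>r. E 0 + integral {0..r} (\<lambda>s. - (norm (W s))\<^sup>2)) has_real_derivative - (norm (W t))\<^sup>2)
      (at t within {0..t + 1})"
    using DERIV_add[OF DERIV_const[of "E 0"] integral_has_real_derivative[OF cont, of t]] t by simp
  moreover have "at t within {0..t + 1} = at t within {0..}"
    using t by (intro at_within_nhd[of _ "{..<t + 1}"]) auto
  ultimately have "((\<lambda>r. E 0 + integral {0..r} (\<lambda>s. - (norm (W s))\<^sup>2)) has_real_derivative
      - (norm (W t))\<^sup>2) (at t within {0..})"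
    by simp
  then show ?thesis
    unfolding E_def[symmetric]
    by (rule has_field_derivative_transform_within[where d = 1])
      (use t integral_unique[OF int] in auto)
qed

section \<open>Functionals on \<open>V\<close> through their representatives \<open>g\<close> in
  \<open>H\<close>\<close>

lemma inv_A_eq:
  assumes "\<And>\<phi>. \<phi> \<in> V \<Longrightarrow> f \<phi> = g \<bullet> S \<phi>"
  shows "inv_A V S f = T g"
  unfolding inv_A_def
proof (rule the_equality)
  show "T g \<in> V \<and> (\<forall>\<phi>\<in>V. ext_op S (T g) \<phi> = f \<phi>)"
    using assms by (simp add: T_in S_T ext_op_def)
next
  fix w assume w: "w \<in> V \<and> (\<forall>\<phi>\<in>V. ext_op S w \<phi> = f \<phi>)"
  \<comment> \<open>Testing with \<open>T h\<close> reaches every \<open>h\<close> in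
    \<open>H\<close>, because \<open>S (T h) = h\<close>.\<close>
  have "S w \<bullet> h = g \<bullet> h" for h
    using w assms T_in[of h] by (auto simp: ext_op_def S_T)
  then have "S w = g"
    by (metis inner_commute vector_eq_ldot)
  then show "w = T g"
    using w T_S by force
qed

text \<open>Pairing \<open>f\<close> with \<open>T g\<close> gives
  \<open>g \<bullet> S (T g) = g \<bullet> g\<close>. Limits in \<open>V'\<close> thereby become
  limits of representatives in \<open>H\<close>.\<close>

lemma norm_dual_eq:
  assumes "\<And>\<phi>. \<phi> \<in> V \<Longrightarrow> f \<phi> = g \<bullet> S \<phi>"
  shows "norm_dual V S f = norm g"
  using inv_A_eq[of f g] assms by (simp add: norm_dual_def inner_dual_def T_in S_T norm_eq_sqrt_inner)

lemma pivot_eq: "\<phi> \<in> V \<Longrightarrow> pivot x \<phi> = T x \<bullet> S \<phi>"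
  by (simp add: pivot_def T_symmetric T_S)

lemma inner_dual_pivot: "inner_dual V S (pivot x) (pivot y) = T x \<bullet> T y"
  using inv_A_eq[OF pivot_eq, of y] by (simp add: inner_dual_def pivot_def T_symmetric)

lemma norm_dual_pivot: "norm_dual V S (pivot x) = norm (T x)"
  by (rule norm_dual_eq) (rule pivot_eq)

end

section \<open>The derivative along weak solutions\<close>

context bounded_inverse_root
begin

text \<open>Linearity of \<open>S\<close> on \<open>V\<close> reduces continuity into
  \<open>V\<close> to continuity of \<open>S\<close> along the curve, in \<open>H\<close>.\<close>

lemma continuous_curve_V_iff:
  "continuous_curve_V V S u \<longleftrightarrow> (\<forall>t\<ge>0. u t \<in> V) \<and> continuous_on {0..} (\<lambda>s. S (u s))"
proof -
  have "((\<lambda>s. norm_V S (u s - u t)) \<longlongrightarrow> 0) (at t within {0..}) \<longleftrightarrow>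
      ((\<lambda>s. S (u s)) \<longlongrightarrow> S (u t)) (at t within {0..})" if "\<forall>t\<ge>0. u t \<in> V" "t \<ge> 0" for t
  proof -
    have "((\<lambda>s. norm_V S (u s - u t)) \<longlongrightarrow> 0) (at t within {0..}) \<longleftrightarrow>
        ((\<lambda>s. norm (S (u s) - S (u t))) \<longlongrightarrow> 0) (at t within {0..})"
      using that
      by (intro tendsto_cong) (auto simp: eventually_at_filter norm_V_def S_diff intro!: always_eventually)
    then show ?thesis
      by (simp only: tendsto_norm_zero_iff LIM_zero_iff)
  qed
  then show ?thesis
    by (auto simp: continuous_curve_V_def continuous_on_def)
qed

text \<open>An element \<open>h\<close> of \<open>H\<close> has the representative
  \<open>T h\<close> in \<open>V'\<close>, so differentiating in \<open>V'\<close> means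
  differentiating \<open>T (w s)\<close> in \<open>H\<close>. The vector \<open>b\<close> is read
  off from the equation.\<close>

lemma C1_curve_dual_pivot:
  assumes F: "C1_curve_dual V S (\<lambda>s. pivot (w s)) F" and t: "t \<ge> 0"
    and eq: "\<And>\<phi>. \<phi> \<in> V \<Longrightarrow> F t \<phi> = b \<bullet> S \<phi>"
  shows "((\<lambda>s. T (w s)) has_vector_derivative b) (at t within {0..})"
proof -
  have quot: "norm_dual V S (\<lambda>\<phi>. (pivot (w s) \<phi> - pivot (w t) \<phi>) / (s - t) - F t \<phi>) =
      norm ((1 / (s - t)) *\<^sub>R (T (w s) - T (w t)) - b)" for s
    by (rule norm_dual_eq) (simp add: pivot_eq eq inner_diff_left)
  have "((\<lambda>s. norm_dual V S (\<lambda>\<phi>. (pivot (w s) \<phi> - pivot (w t) \<phi>) / (s - t) - F t \<phi>)) \<longlongrightarrow> 0)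
      (at t within {0..})"
    using F t unfolding C1_curve_dual_def by blast
  then have "((\<lambda>s. norm ((1 / (s - t)) *\<^sub>R (T (w s) - T (w t)) - b)) \<longlongrightarrow> 0) (at t within {0..})"
    unfolding quot .
  then show ?thesis
    by (simp only: has_vector_derivative_iff_quotient tendsto_norm_zero_iff LIM_zero_iff)
qed

text \<open>The energy identity is combined with product rules for the terms of order
  \<open>\<epsilon>\<close>. In each of these at least one factor is a value of \<open>T\<close>,
  which is paired with the unbounded part of the equation.\<close>

lemma H_form_has_derivative:
  fixes Q :: "nat \<Rightarrow> 'h \<Rightarrow> 'h" and c p \<epsilon> :: real
  assumes Q: "\<And>n. bounded_linear (Q n)" "\<And>n x. T (Q n x) = Q n (T x)"
    "\<And>n x. norm (T (Q n x)) \<le> norm x" "\<And>x. (\<lambda>n. T (Q n x)) \<longlonglongrightarrow> x"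
    and sol: "weak_solution V S c u v u' v'" and t: "t \<ge> 0"
    and \<rho>: "\<rho> = (p + 1) * l / (2 * c)"
  shows "((\<lambda>s. H_form V S l c p \<epsilon> (u s) (v s) (u' s) (v' s)) has_real_derivative
    - (norm (u' t))\<^sup>2
    - \<epsilon> * l * ((norm (T (v' t)))\<^sup>2 - (norm (v t))\<^sup>2 - c * (T (u t) \<bullet> T (v t)))
    + p * \<epsilon> * ((norm (u' t))\<^sup>2 - u t \<bullet> u' t - (norm (S (u t)))\<^sup>2 - c * (u t \<bullet> v t))
    + \<rho> * \<epsilon> * (c * (norm (u t))\<^sup>2 - c * (norm (v t))\<^sup>2 - u' t \<bullet> v t)) (at t within {0..})"
proof -
  define U where "U s = S (u s)" for s
  define Y where "Y s = S (v s)" for s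
  have V: "\<And>s. s \<ge> 0 \<Longrightarrow> u s \<in> V" "\<And>s. s \<ge> 0 \<Longrightarrow> v s \<in> V"
    and contU: "continuous_on {0..} U" and contY: "continuous_on {0..} Y"
    using sol by (auto simp: weak_solution_def continuous_curve_V_iff U_def Y_def)
  have TU: "T (U s) = u s" and TY: "T (Y s) = v s" if "s \<ge> 0" for s
    using V that by (auto simp: U_def Y_def T_S)
  have contW: "continuous_on {0..} u'"
    and du: "\<And>s. s \<ge> 0 \<Longrightarrow> (u has_vector_derivative u' s) (at s within {0..})"
    and dv: "\<And>s. s \<ge> 0 \<Longrightarrow> (v has_vector_derivative v' s) (at s within {0..})"
    using sol by (auto simp: weak_solution_def C1_curve_H_def)
  have dU: "((\<lambda>s. T (U s)) has_vector_derivative u' s) (at s within {0..})" if "s \<ge> 0" for s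
    by (rule has_vector_derivative_transform[OF _ _ du]) (use that TU in auto)
  have dY: "((\<lambda>s. T (Y s)) has_vector_derivative v' s) (at s within {0..})" if "s \<ge> 0" for s
    by (rule has_vector_derivative_transform[OF _ _ dv]) (use that TY in auto)
  obtain u'' v'' where u'': "C1_curve_dual V S (\<lambda>s. pivot (u' s)) u''"
    and v'': "C1_curve_dual V S (\<lambda>s. pivot (v' s)) v''"
    and eqs: "\<And>s \<phi>. s \<ge> 0 \<Longrightarrow> \<phi> \<in> V \<Longrightarrow>
      u'' s \<phi> + pivot (u' s) \<phi> + ext_op S (u s) \<phi> + c * pivot (v s) \<phi> = 0 \<and>
      v'' s \<phi> + ext_op S (v s) \<phi> + c * pivot (u s) \<phi> = 0"
    using sol unfolding weak_solution_def by blast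
  have dW: "((\<lambda>s. T (u' s)) has_vector_derivative - (T (u' s) + U s + c *\<^sub>R T (T (Y s))))
      (at s within {0..})" if s: "s \<ge> 0" for s
  proof (rule C1_curve_dual_pivot[OF u'' s])
    fix \<phi> assume "\<phi> \<in> V"
    then show "u'' s \<phi> = - (T (u' s) + U s + c *\<^sub>R T (T (Y s))) \<bullet> S \<phi>"
      using eqs[OF s, of \<phi>] s
      by (simp add: pivot_eq ext_op_def U_def[symmetric] TY inner_add_left inner_diff_left)
  qed
  have dZ: "((\<lambda>s. T (v' s)) has_vector_derivative - (Y s + c *\<^sub>R T (T (U s))))
      (at s within {0..})" if s: "s \<ge> 0" for s
  proof (rule C1_curve_dual_pivot[OF v'' s])
    fix \<phi> assume "\<phi> \<in> V"
    then show "v'' s \<phi> = - (Y s + c *\<^sub>R T (T (U s))) \<bullet> S \<phi>"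
      using eqs[OF s, of \<phi>] s
      by (simp add: pivot_eq ext_op_def Y_def[symmetric] TU inner_add_left inner_diff_left)
  qed
  have cU: "continuous (at t within {0..}) U" and cY: "continuous (at t within {0..}) Y"
    using contU contY t by (auto simp: continuous_on_eq_continuous_within)
  have Tv: "((\<lambda>s. T (T (Y s))) has_vector_derivative T (v' t)) (at t within {0..})"
    by (rule bounded_linear.has_vector_derivative[OF T_linear dY[OF t]])
  note E = energy_derivative[OF Q contW dU dY dW dZ t]
  note uw = has_real_derivative_T_inner[OF cU dU[OF t] dW[OF t]]
  note vw = has_real_derivative_T_inner[OF cY dY[OF t] dW[OF t]]
  note uz = has_real_derivative_T_inner[OF cU dU[OF t] dZ[OF t]]
  note vz = has_real_derivative_inner[OF Tv dZ[OF t]]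
  have UT: "U t \<bullet> T x = u t \<bullet> x" and YT: "Y t \<bullet> T x = v t \<bullet> x" for x
    using T_symmetric[of "U t" x] T_symmetric[of "Y t" x] TU[OF t] TY[OF t] by auto
  have Yv: "T (v t) \<bullet> Y t = v t \<bullet> v t"
    using T_symmetric[of "v t" "Y t"] TY[OF t] by simp
  have vz': "T (T (Y t)) \<bullet> - (Y t + c *\<^sub>R T (T (U t))) = - (norm (v t))\<^sup>2 - c * (T (u t) \<bullet> T (v t))"
    unfolding TY[OF t] TU[OF t]
    by (simp add: inner_diff_right Yv power2_norm_eq_inner inner_commute[of "T (v t)" "T (u t)"])
  have uw': "U t \<bullet> - (T (u' t) + U t + c *\<^sub>R T (T (Y t))) =
      - (u t \<bullet> u' t) - (norm (S (u t)))\<^sup>2 - c * (u t \<bullet> v t)"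
    unfolding TY[OF t] by (simp add: inner_diff_right UT power2_norm_eq_inner U_def[of t, symmetric])
  \<comment> \<open>The term \<open>U t \<bullet> Y t\<close> here and in \<open>uz'\<close> cannot
    be controlled by the desired right side. The difference in the bracket with factor
    \<open>\<rho>\<close> removes it, along with \<open>u' t \<bullet> v' t\<close>.\<close>
  have vw': "Y t \<bullet> - (T (u' t) + U t + c *\<^sub>R T (T (Y t))) =
      - (u' t \<bullet> v t) - U t \<bullet> Y t - c * (norm (v t))\<^sup>2"
    unfolding TY[OF t]
    by (simp add: inner_diff_right YT power2_norm_eq_inner inner_commute[of "Y t" "U t"]
        inner_commute[of "v t" "u' t"])
  have uz': "U t \<bullet> - (Y t + c *\<^sub>R T (T (U t))) = - (U t \<bullet> Y t) - c * (norm (u t))\<^sup>2"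
    unfolding TU[OF t] by (simp add: inner_diff_right UT power2_norm_eq_inner)
  have "((\<lambda>s. 1/2 * ((norm (U s))\<^sup>2 + (norm (Y s))\<^sup>2 + (norm (u' s))\<^sup>2 + (norm (v' s))\<^sup>2)
      + c * (T (U s) \<bullet> T (Y s)) - \<epsilon> * l * (T (T (Y s)) \<bullet> T (v' s))
      + p * \<epsilon> * (T (U s) \<bullet> u' s) + \<rho> * \<epsilon> * (T (Y s) \<bullet> u' s - T (U s) \<bullet> v' s))
      has_real_derivative
      - (norm (u' t))\<^sup>2
    - \<epsilon> * l * ((norm (T (v' t)))\<^sup>2 - (norm (v t))\<^sup>2 - c * (T (u t) \<bullet> T (v t)))
    + p * \<epsilon> * ((norm (u' t))\<^sup>2 - u t \<bullet> u' t - (norm (S (u t)))\<^sup>2 - c * (u t \<bullet> v t))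
    + \<rho> * \<epsilon> * (c * (norm (u t))\<^sup>2 - c * (norm (v t))\<^sup>2 - u' t \<bullet> v t)) (at t within {0..})"
    by (rule DERIV_cong[OF DERIV_add[OF DERIV_add[OF DERIV_diff[OF E
            DERIV_cmult[OF vz]] DERIV_cmult[OF uw]] DERIV_cmult[OF DERIV_diff[OF vw uz]]]])
      (unfold vz' uw' vw' uz' power2_norm_eq_inner[symmetric] inner_commute[of "v' t" "u' t"],
        simp_all add: algebra_simps)
  then show ?thesis
    by (rule has_field_derivative_transform_within[where d = 1])
      (use t in \<open>auto simp: H_form_def Let_def energy_def norm_V_def inner_dual_pivot \<rho>
        U_def[symmetric] Y_def[symmetric] TU TY inner_commute\<close>)
qed

end

text \<open>Here \<open>a\<close>, \<open>b\<close>, \<open>w\<close> stand for |u|, |v|, |u'|,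
  \<open>n\<close> for the squared norm of \<open>u\<close> in \<open>V\<close>, \<open>k\<close>
  for the squared dual norm of \<open>v'\<close>, and \<open>tuv\<close> for the dual inner product
  of \<open>u\<close> and \<open>v\<close>. The margin \<open>\<eta>\<close> is what the condition
  on \<open>p\<close> leaves after the coupling terms.\<close>

lemma dissipation_estimate:
  fixes a b w k n uw uv wv tuv l c p \<epsilon> :: real
  assumes \<rho>: "\<rho> = (p + 1) * l / (2 * c)" and \<eta>: "\<eta> = l * (p - 1) - \<bar>c\<bar> * (p + 1)" "\<eta> > 0"
    and c: "c \<noteq> 0" and p: "p > 1" and \<epsilon>: "\<epsilon> > 0"
    and uw: "\<bar>uw\<bar> \<le> a * w" and uv: "\<bar>uv\<bar> \<le> a * b" and wv: "\<bar>wv\<bar> \<le> w * b"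
    and tuv: "l * \<bar>tuv\<bar> \<le> a * b" and n: "l * a\<^sup>2 \<le> n" and l: "l > 0"
  shows "- w\<^sup>2 - \<epsilon> * l * (k - b\<^sup>2 - c * tuv) + p * \<epsilon> * (w\<^sup>2 - uw - n - c * uv)
      + \<rho> * \<epsilon> * (c * a\<^sup>2 - c * b\<^sup>2 - wv)
    \<le> - ((1 - \<epsilon> * (p + (p\<^sup>2 + \<rho>\<^sup>2) / \<eta>)) * w\<^sup>2) - \<epsilon> * \<eta> / 4 * (a\<^sup>2 + b\<^sup>2) - \<epsilon> * l * k"
proof -
  \<comment> \<open>The weight \<open>\<eta> / 4\<close> is chosen because the available margin is
    \<open>\<eta> / 2\<close> on each square: \<open>a\<close> and \<open>b\<close> each spend half
    of it on one product with \<open>w\<close>.\<close>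
  have young: "r * x * w \<le> \<eta> / 4 * x\<^sup>2 + r\<^sup>2 / \<eta> * w\<^sup>2" for r x
  proof -
    have "0 \<le> (\<eta> * x - 2 * r * w)\<^sup>2 / (4 * \<eta>)"
      using \<eta>(2) by simp
    also have "\<dots> = \<eta> / 4 * x\<^sup>2 + r\<^sup>2 / \<eta> * w\<^sup>2 - r * x * w"
      using \<eta>(2) by (simp add: power2_eq_square field_simps)
    finally show ?thesis
      by simp
  qed
  have 1: "c * (l * tuv) \<le> \<bar>c\<bar> * (a * b)"
  proof -
    have "c * (l * tuv) \<le> \<bar>c\<bar> * \<bar>l * tuv\<bar>"
      by (metis abs_ge_self abs_mult)
    also have "\<dots> \<le> \<bar>c\<bar> * (a * b)"
      using tuv l by (intro mult_left_mono) (auto simp: abs_mult)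
    finally show ?thesis .
  qed
  have 2: "- (p * (c * uv)) \<le> p * (\<bar>c\<bar> * (a * b))"
  proof -
    have "- (c * uv) \<le> \<bar>c\<bar> * \<bar>uv\<bar>"
      by (metis abs_ge_minus_self abs_mult)
    also have "\<dots> \<le> \<bar>c\<bar> * (a * b)"
      using uv by (intro mult_left_mono) auto
    finally have "p * - (c * uv) \<le> p * (\<bar>c\<bar> * (a * b))"
      using p by (intro mult_left_mono) auto
    then show ?thesis
      by simp
  qed
  have 3: "- (p * uw) \<le> p * a * w"
    using uw p mult_left_mono[of "- uw" "a * w" p] by (simp add: mult.assoc)
  have 4: "- (\<rho> * wv) \<le> \<bar>\<rho>\<bar> * b * w"
  proof -
    have "- (\<rho> * wv) \<le> \<bar>\<rho>\<bar> * \<bar>wv\<bar>"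
      by (metis abs_ge_minus_self abs_mult)
    also have "\<dots> \<le> \<bar>\<rho>\<bar> * (w * b)"
      using wv by (intro mult_left_mono) auto
    finally show ?thesis
      by (simp add: mult_ac)
  qed
  \<comment> \<open>The factor \<open>p + 1\<close> collects one coupling term from
    \<open>tuv\<close> and \<open>p\<close> of them from \<open>uv\<close>.\<close>
  have 5: "(p + 1) * \<bar>c\<bar> * (a * b) \<le> (p + 1) * \<bar>c\<bar> * ((a\<^sup>2 + b\<^sup>2) / 2)"
  proof (rule mult_left_mono)
    show "a * b \<le> (a\<^sup>2 + b\<^sup>2) / 2"
      using sum_squares_bound[of a b] by simp
  qed (use p in auto)
  have 6: "p * (l * a\<^sup>2) \<le> p * n"
    using n p by (intro mult_left_mono) auto
  have \<rho>c: "\<rho> * c = (p + 1) * l / 2"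
    using c by (simp add: \<rho>)
  have "- (l * (k - b\<^sup>2 - c * tuv)) + p * (w\<^sup>2 - uw - n - c * uv) + (\<rho> * c * (a\<^sup>2 - b\<^sup>2) - \<rho> * wv)
      \<le> - (l * k) + l * b\<^sup>2 + (p + 1) * \<bar>c\<bar> * ((a\<^sup>2 + b\<^sup>2) / 2) + p * w\<^sup>2
        + (\<eta> / 4 * a\<^sup>2 + p\<^sup>2 / \<eta> * w\<^sup>2) - p * (l * a\<^sup>2) + \<rho> * c * (a\<^sup>2 - b\<^sup>2)
        + (\<eta> / 4 * b\<^sup>2 + \<rho>\<^sup>2 / \<eta> * w\<^sup>2)"
    using 1 2 order.trans[OF 3 young[of p a]] order.trans[OF 4 young[of "\<bar>\<rho>\<bar>" b]] 5 6
    by (simp add: algebra_simps add_divide_distrib)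
  \<comment> \<open>The coefficients \<open>- p * l + (p + 1) * l / 2\<close> of
    \<open>a\<^sup>2\<close> and \<open>l - (p + 1) * l / 2\<close> of \<open>b\<^sup>2\<close> both
    equal \<open>- l * (p - 1) / 2\<close>. Adding \<open>\<bar>c\<bar> * (p + 1) / 2\<close> gives
    \<open>- \<eta> / 2\<close>, and the Young terms leave \<open>- \<eta> / 4\<close>.\<close>
  also have "\<dots> = (p + (p\<^sup>2 + \<rho>\<^sup>2) / \<eta>) * w\<^sup>2 - \<eta> / 4 * (a\<^sup>2 + b\<^sup>2) - l * k"
  proof -
    have "l * b\<^sup>2 + (p + 1) * \<bar>c\<bar> * ((a\<^sup>2 + b\<^sup>2) / 2) + \<eta> / 4 * a\<^sup>2 - p * (l * a\<^sup>2)
        + (p + 1) * l / 2 * (a\<^sup>2 - b\<^sup>2) + \<eta> / 4 * b\<^sup>2 = - (\<eta> / 4 * (a\<^sup>2 + b\<^sup>2))"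
      unfolding \<eta>(1) by (simp add: field_simps)
    then show ?thesis
      unfolding \<rho>c by (simp add: algebra_simps add_divide_distrib)
  qed
  finally have "\<epsilon> * (- (l * (k - b\<^sup>2 - c * tuv)) + p * (w\<^sup>2 - uw - n - c * uv) + (\<rho> * c * (a\<^sup>2 - b\<^sup>2) - \<rho> * wv))
      \<le> \<epsilon> * ((p + (p\<^sup>2 + \<rho>\<^sup>2) / \<eta>) * w\<^sup>2 - \<eta> / 4 * (a\<^sup>2 + b\<^sup>2) - l * k)"
    using \<epsilon> by (intro mult_left_mono) auto
  then show ?thesis
    by (simp add: algebra_simps)
qed

section \<open>Choice of the constants and conclusion\<close>

theorem theorem7p1:
  fixes D V :: "'h::{real_inner, complete_space} set"
    and A S :: "'h \<Rightarrow> 'h"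
    and lambda1 c p :: real
  assumes "separable_space (euclidean :: 'h topology)"
    and "self_adjoint D A" and "positive_op D A" and "coercive_op D A"
    and "is_sqrt_op D A V S"
    and "smallest_spectral_value D A lambda1"
    and "c \<noteq> 0" and "\<bar>c\<bar> < lambda1"
    and "p > 1" and "(p + 1) / (p - 1) < lambda1 / \<bar>c\<bar>"
  shows "\<exists>\<epsilon>\<^sub>0>0. \<forall>\<epsilon>. 0 < \<epsilon> \<and> \<epsilon> < \<epsilon>\<^sub>0 \<longrightarrow>
    (\<exists>\<gamma>>0. \<forall>u v u' v'. weak_solution V S c u v u' v' \<longrightarrow>
      (\<forall>t\<ge>0. \<exists>d.
        ((\<lambda>s. H_form V S lambda1 c p \<epsilon> (u s) (v s) (u' s) (v' s)) has_real_derivative d)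
          (at t within {0..}) \<and>
        d \<le> - \<gamma> * (1/2 * ((norm (u t))\<^sup>2 + (norm (v t))\<^sup>2
               + (norm_dual V S (pivot (u' t)))\<^sup>2 + (norm_dual V S (pivot (v' t)))\<^sup>2))))"
proof -
  have l: "lambda1 > 0"
    using assms(8) by linarith
  define T where "T = inv_into V S"
  have root: "bounded_inverse_root V S T lambda1"
    unfolding T_def by (rule bounded_inverse_root_exists) (use assms l in auto)
  interpret bounded_inverse_root V S T lambda1
    by (rule root)
  obtain Q :: "nat \<Rightarrow> 'h \<Rightarrow> 'h" where Q: "\<And>n. bounded_linear (Q n)" "\<And>n x. T (Q n x) = Q n (T x)"
    "\<And>n x. norm (T (Q n x)) \<le> norm x" "\<And>x. (\<lambda>n. T (Q n x)) \<longlonglongrightarrow> x"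
    using regularisers_exist[OF assms(2,3,5,6) root] by blast
  define \<rho> where "\<rho> = (p + 1) * lambda1 / (2 * c)"
  define \<eta> where "\<eta> = lambda1 * (p - 1) - \<bar>c\<bar> * (p + 1)"
  \<comment> \<open>This is the condition on \<open>p\<close> with the denominators cleared.\<close>
  have \<eta>: "\<eta> > 0"
    using assms(7,9,10) by (simp add: \<eta>_def field_simps)
  \<comment> \<open>\<open>\<epsilon> * M\<close> is the part of the damping consumed by the terms
    of order \<open>\<epsilon>\<close>, which is why \<open>1 / M\<close> serves as
    threshold.\<close>
  define M where "M = p + (p\<^sup>2 + \<rho>\<^sup>2) / \<eta>"
  have M: "M > 0"
    using \<eta> assms(9) by (simp add: M_def add_pos_nonneg)
  show ?thesis
  proof (rule exI[of _ "1 / M"], intro conjI allI impI)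
    show "1 / M > 0"
      using M by simp
  next
    fix \<epsilon> assume "0 < \<epsilon> \<and> \<epsilon> < 1 / M"
    then have \<epsilon>: "\<epsilon> > 0" and \<epsilon>M: "1 - \<epsilon> * M > 0"
      using M by (auto simp: field_simps)
    \<comment> \<open>The entries belong to \<open>u'\<close>, to \<open>u\<close> and
      \<open>v\<close>, and to \<open>v'\<close>. The first carries \<open>lambda1\<close> because
      the damping controls |u'|, which is then weakened to the dual norm.\<close>
    define \<gamma> where "\<gamma> = Min {(1 - \<epsilon> * M) * lambda1, \<epsilon> * \<eta> / 4, \<epsilon> * lambda1}"
    have \<gamma>: "\<gamma> > 0" "\<gamma> \<le> (1 - \<epsilon> * M) * lambda1" "\<gamma> \<le> \<epsilon> * \<eta> / 4" "\<gamma> \<le> \<epsilon> * lambda1"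
      using \<epsilon> \<epsilon>M \<eta> l by (auto simp: \<gamma>_def)
    have "\<exists>d. ((\<lambda>s. H_form V S lambda1 c p \<epsilon> (u s) (v s) (u' s) (v' s)) has_real_derivative d)
          (at t within {0..}) \<and>
        d \<le> - \<gamma> * (1/2 * ((norm (u t))\<^sup>2 + (norm (v t))\<^sup>2
               + (norm_dual V S (pivot (u' t)))\<^sup>2 + (norm_dual V S (pivot (v' t)))\<^sup>2))"
      if sol: "weak_solution V S c u v u' v'" and t: "t \<ge> 0" for u v u' v' t
    proof (intro exI conjI)
      show "((\<lambda>s. H_form V S lambda1 c p \<epsilon> (u s) (v s) (u' s) (v' s)) has_real_derivative
          - (norm (u' t))\<^sup>2
          - \<epsilon> * lambda1 * ((norm (T (v' t)))\<^sup>2 - (norm (v t))\<^sup>2 - c * (T (u t) \<bullet> T (v t)))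
          + p * \<epsilon> * ((norm (u' t))\<^sup>2 - u t \<bullet> u' t - (norm (S (u t)))\<^sup>2 - c * (u t \<bullet> v t))
          + \<rho> * \<epsilon> * (c * (norm (u t))\<^sup>2 - c * (norm (v t))\<^sup>2 - u' t \<bullet> v t)) (at t within {0..})"
        (is "(_ has_real_derivative ?d) _")
        by (rule H_form_has_derivative[OF Q sol t \<rho>_def])
      \<comment> \<open>Squaring lets \<open>T_bound\<close> be used once for each factor, each use
        absorbing one \<open>lambda1\<close>.\<close>
      have Tu: "lambda1 * \<bar>T (u t) \<bullet> T (v t)\<bar> \<le> norm (u t) * norm (v t)"
      proof (rule power2_le_imp_le)
        have "(lambda1 * \<bar>T (u t) \<bullet> T (v t)\<bar>)\<^sup>2 \<le> (lambda1 * (norm (T (u t)) * norm (T (v t))))\<^sup>2"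
          using l by (intro power_mono mult_left_mono Cauchy_Schwarz_ineq2) auto
        also have "\<dots> = (lambda1 * (norm (T (u t)))\<^sup>2) * (lambda1 * (norm (T (v t)))\<^sup>2)"
          by (simp add: power2_eq_square)
        also have "\<dots> \<le> (norm (u t))\<^sup>2 * (norm (v t))\<^sup>2"
          using l by (intro mult_mono T_bound) auto
        finally show "(lambda1 * \<bar>T (u t) \<bullet> T (v t)\<bar>)\<^sup>2 \<le> (norm (u t) * norm (v t))\<^sup>2"
          by (simp add: power_mult_distrib)
      qed auto
      have "u t \<in> V"
        using sol t by (auto simp: weak_solution_def continuous_curve_V_def)
      then have Su: "lambda1 * (norm (u t))\<^sup>2 \<le> (norm (S (u t)))\<^sup>2"
        using T_bound[of "S (u t)"] by (simp add: T_S)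
      have "?d \<le> - ((1 - \<epsilon> * M) * (norm (u' t))\<^sup>2) - \<epsilon> * \<eta> / 4 * ((norm (u t))\<^sup>2 + (norm (v t))\<^sup>2)
          - \<epsilon> * lambda1 * (norm (T (v' t)))\<^sup>2"
        unfolding M_def
        by (rule dissipation_estimate[OF \<rho>_def \<eta>_def \<eta> assms(7,9) \<epsilon>
              Cauchy_Schwarz_ineq2 Cauchy_Schwarz_ineq2 Cauchy_Schwarz_ineq2 Tu Su l])
      also have "\<dots> \<le> - (\<gamma> * (norm (T (u' t)))\<^sup>2) - \<gamma> * ((norm (u t))\<^sup>2 + (norm (v t))\<^sup>2)
          - \<gamma> * (norm (T (v' t)))\<^sup>2"
      proof -
        have "\<gamma> * (norm (T (u' t)))\<^sup>2 \<le> (1 - \<epsilon> * M) * lambda1 * (norm (T (u' t)))\<^sup>2"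
          by (intro mult_right_mono \<gamma>) auto
        also have "\<dots> \<le> (1 - \<epsilon> * M) * (norm (u' t))\<^sup>2"
          using \<epsilon>M T_bound[of "u' t"] by (simp add: mult.assoc)
        finally have "\<gamma> * (norm (T (u' t)))\<^sup>2 \<le> (1 - \<epsilon> * M) * (norm (u' t))\<^sup>2" .
        moreover have "\<gamma> * ((norm (u t))\<^sup>2 + (norm (v t))\<^sup>2) \<le> \<epsilon> * \<eta> / 4 * ((norm (u t))\<^sup>2 + (norm (v t))\<^sup>2)"
          by (intro mult_right_mono \<gamma>) auto
        moreover have "\<gamma> * (norm (T (v' t)))\<^sup>2 \<le> \<epsilon> * lambda1 * (norm (T (v' t)))\<^sup>2"
          by (intro mult_right_mono \<gamma>) auto
        ultimately show ?thesis
          by linarith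
      qed
      also have "\<dots> = - (\<gamma> * ((norm (u t))\<^sup>2 + (norm (v t))\<^sup>2
               + (norm (T (u' t)))\<^sup>2 + (norm (T (v' t)))\<^sup>2))"
        by (simp add: algebra_simps)
      \<comment> \<open>The sum of squares is nonnegative, so inserting the factor 1/2 only weakens
        the bound.\<close>
      also have "\<dots> \<le> - \<gamma> * (1/2 * ((norm (u t))\<^sup>2 + (norm (v t))\<^sup>2
               + (norm_dual V S (pivot (u' t)))\<^sup>2 + (norm_dual V S (pivot (v' t)))\<^sup>2))"
        using \<gamma>(1) by (simp add: norm_dual_pivot)
      finally show "?d \<le> - \<gamma> * (1/2 * ((norm (u t))\<^sup>2 + (norm (v t))\<^sup>2
               + (norm_dual V S (pivot (u' t)))\<^sup>2 + (norm_dual V S (pivot (v' t)))\<^sup>2))" .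
    qed
    then show "\<exists>\<gamma>>0. \<forall>u v u' v'. weak_solution V S c u v u' v' \<longrightarrow>
      (\<forall>t\<ge>0. \<exists>d.
        ((\<lambda>s. H_form V S lambda1 c p \<epsilon> (u s) (v s) (u' s) (v' s)) has_real_derivative d)
          (at t within {0..}) \<and>
        d \<le> - \<gamma> * (1/2 * ((norm (u t))\<^sup>2 + (norm (v t))\<^sup>2
               + (norm_dual V S (pivot (u' t)))\<^sup>2 + (norm_dual V S (pivot (v' t)))\<^sup>2)))"
      using \<gamma>(1) by blast
  qed
qed

end
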